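(* Let $\alpha,\beta>0$ with $\alpha+\beta=1$ and let $\gamma=1$. Let $X_j^n$ be the forest-fire random field with parameters $\alpha,\beta,\gamma$, and let $Y_n=\sum_{j=0}^n X_j^n$ for $n\ge0$. Then $\mathbb{E}[Y_n]=1$ for all $n\ge0$.
   Context: Forest-fire random field with parameters $\alpha,\beta,\gamma$, where $0\le\alpha,\beta\le\gamma\le1$: $\mathbb{N}=\{0,1,2,\ldots\}$. A family of $\{0,1\}$-valued random variables $X(j,k)$, $j,k\in\mathbb{N}$, is given on a probability space; write $X_j^n=X(j,n-j)$ for $0\le j\le n$. Boundary conditions: $X(0,0)=1$ and $X(j,-1)=X(-1,k)=0$ for all $j,k\in\mathbb{N}$, i.e. $X_0^0=1$ and $X_{-1}^n=X_{n+1}^n=0$ for all $n\ge0$. Let $\mathcal{F}_n=\sigma(X_j^m:\ 0\le j\le m\le n)$. The law of the field is defined inductively: for every $n\ge0$, given $\mathcal{F}_n$, the variables $X_0^{n+1},\ldots,X_{n+1}^{n+1}$ are conditionally independent, and for each $0\le j\le n+1$ the conditional law of $X_j^{n+1}$ given $\mathcal{F}_n$ depends only on $(X_{j-1}^n,X_j^n)$: the conditional probability that $X_j^{n+1}=1$ equals $0$ if $(X_{j-1}^n,X_j^n)=(0,0)$, equals $\alpha$ if it is $(1,0)$, equals $\beta$ if it is $(0,1)$, and equals $\gamma$ if it is $(1,1)$. *)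

theory Defs
  imports "HOL-Probability.Probability"
begin

definition cond_indep_vars ::
  "'a measure \<Rightarrow> 'a measure \<Rightarrow> ('i \<Rightarrow> 'b measure) \<Rightarrow> ('i \<Rightarrow> 'a \<Rightarrow> 'b) \<Rightarrow> 'i set \<Rightarrow> bool"
where
  "cond_indep_vars M F N Z I \<longleftrightarrow>
     (\<forall>i\<in>I. Z i \<in> measurable M (N i)) \<and>
     (\<forall>J A. finite J \<and> J \<subseteq> I \<and> (\<forall>j\<in>J. A j \<in> sets (N j)) \<longrightarrow>
        (AE \<omega> in M. real_cond_exp M F (indicator {x \<in> space M. \<forall>j\<in>J. Z j x \<in> A j}) \<omega> =
           (\<Prod>j\<in>J. real_cond_exp M F (indicator {x \<in> space M. Z j x \<in> A j}) \<omega>)))"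

text \<open>
  The value \<open>diag X n j\<close> is $X_j^n = X(j, n-j)$.  The index \<open>j\<close> is an integer, and the value
  outside $0 \le j \le n$ is 0; this encodes the boundary convention
  $X(j,-1) = X(-1,k) = 0$, i.e. $X_{-1}^n = X_{n+1}^n = 0$.
\<close>

definition diag :: "(nat \<Rightarrow> nat \<Rightarrow> 'a \<Rightarrow> real) \<Rightarrow> nat \<Rightarrow> int \<Rightarrow> 'a \<Rightarrow> real" where
  "diag X n j \<omega> = (if 0 \<le> j \<and> j \<le> int n then X (nat j) (n - nat j) \<omega> else 0)"

definition diag_sigma :: "'a measure \<Rightarrow> (nat \<Rightarrow> nat \<Rightarrow> 'a \<Rightarrow> real) \<Rightarrow> nat \<Rightarrow> 'a measure" where
  "diag_sigma M X n =
     sigma (space M)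
       {diag X m (int j) -` A \<inter> space M | j m A. j \<le> m \<and> m \<le> n \<and> A \<in> sets borel}"

definition transition_prob :: "real \<Rightarrow> real \<Rightarrow> real \<Rightarrow> real \<Rightarrow> real \<Rightarrow> real" where
  "transition_prob \<alpha> \<beta> \<gamma> a b =
     (if (a, b) = (1, 0) then \<alpha>
      else if (a, b) = (0, 1) then \<beta>
      else if (a, b) = (1, 1) then \<gamma>
      else 0)"

locale forest_fire = prob_space M
  for M :: "'a measure"
    and X :: "nat \<Rightarrow> nat \<Rightarrow> 'a \<Rightarrow> real"
    and \<alpha> \<beta> \<gamma> :: real +
  assumes params: "0 \<le> \<alpha>" "\<alpha> \<le> \<gamma>" "0 \<le> \<beta>" "\<beta> \<le> \<gamma>" "\<gamma> \<le> 1"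
    and random_variables: "\<And>j k. random_variable borel (X j k)"
    and zero_one_valued: "\<And>j k \<omega>. \<omega> \<in> space M \<Longrightarrow> X j k \<omega> \<in> {0, 1}"
    and initial: "AE \<omega> in M. X 0 0 \<omega> = 1"
    and conditional_independence:
      "\<And>n. cond_indep_vars M (diag_sigma M X n) (\<lambda>_. borel)
              (\<lambda>j. diag X (Suc n) (int j)) {0..Suc n}"
    and conditional_law:
      "\<And>n j. j \<le> Suc n \<Longrightarrow>
         AE \<omega> in M.
           real_cond_exp M (diag_sigma M X n)
             (indicator {x \<in> space M. diag X (Suc n) (int j) x = 1}) \<omega> =
           transition_prob \<alpha> \<beta> \<gamma> (diag X n (int j - 1) \<omega>) (diag X n (int j) \<omega>)"

definition diag_sum :: "(nat \<Rightarrow> nat \<Rightarrow> 'a \<Rightarrow> real) \<Rightarrow> nat \<Rightarrow> 'a \<Rightarrow> real" where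
  "diag_sum X n \<omega> = (\<Sum>j = 0..n. diag X n (int j) \<omega>)"

end

theory Submission
  imports Defs
begin

(* For gamma = alpha + beta = 1 the transition probability is the linear function
   alpha * a + beta * b of the two parents, so taking expectations each site passes
   a total weight alpha + beta = 1 to its two children. *)

text \<open>At (0,0), (1,0) and (0,1) both sides agree by definition; the hypothesis
  \<open>\<alpha> + \<beta> = \<gamma>\<close> enters at (1,1).\<close>

lemma transition_prob_linear:
  assumes "a \<in> {0, 1}" "b \<in> {0, 1}" "\<alpha> + \<beta> = \<gamma>"
  shows "transition_prob \<alpha> \<beta> \<gamma> a b = \<alpha> * a + \<beta> * b"
  using assms by (auto simp: transition_prob_def)

context forest_fire
begin

lemma diag_measurable [measurable]: "diag X n j \<in> borel_measurable M"
  unfolding diag_def [abs_def] using random_variables by measurable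

lemma diag_zero_one: "\<omega> \<in> space M \<Longrightarrow> diag X n j \<omega> \<in> {0, 1}"
  unfolding diag_def using zero_one_valued by auto

lemma integrable_diag [simp]: "integrable M (diag X n j)"
proof (rule integrable_const_bound [where B = 1])
  show "AE \<omega> in M. norm (diag X n j \<omega>) \<le> 1"
  proof (rule AE_I2)
    fix \<omega> assume "\<omega> \<in> space M"
    from diag_zero_one [OF this, of n j] show "norm (diag X n j \<omega>) \<le> 1"
      by auto
  qed
qed measurable

text \<open>Gives the conditional expectation given the past up to row \<open>n\<close> its defining
  properties, in particular the tower property.\<close>

lemma subalgebra_diag_sigma: "subalgebra M (diag_sigma M X n)"
proof -
  let ?G = "{diag X m (int j) -` A \<inter> space M | j m A. j \<le> m \<and> m \<le> n \<and> A \<in> sets borel}"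
  have "?G \<subseteq> sets M"
    using diag_measurable by (auto intro: measurable_sets)
  moreover have "?G \<subseteq> Pow (space M)"
    by auto
  ultimately show ?thesis
    unfolding subalgebra_def diag_sigma_def
    by (simp add: sets.sigma_sets_subset)
qed

lemma expectation_diag_Suc:
  assumes "\<alpha> + \<beta> = \<gamma>" "j \<le> Suc n"
  shows "expectation (diag X (Suc n) (int j)) =
    \<alpha> * expectation (diag X n (int j - 1)) + \<beta> * expectation (diag X n (int j))"
proof -
  interpret finite_measure_subalgebra M "diag_sigma M X n"
    by unfold_locales (rule subalgebra_diag_sigma)
  let ?A = "{x \<in> space M. diag X (Suc n) (int j) x = 1}"
  \<comment> \<open>A zero-one variable is the indicator of the event that it equals 1, which is the
    form \<open>conditional_law\<close> speaks about.\<close>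
  have "expectation (diag X (Suc n) (int j)) = expectation (indicator ?A)"
    using diag_zero_one by (intro Bochner_Integration.integral_cong) (fastforce simp: indicator_def)+
  \<comment> \<open>Tower property; the indicator is integrable because the measure is
    finite.\<close>
  also have "\<dots> = expectation (real_cond_exp M (diag_sigma M X n) (indicator ?A))"
    by (rule real_cond_exp_int(2) [symmetric], rule integrable_real_indicator)
      (simp_all add: less_top [symmetric])
  also have "\<dots> = expectation (\<lambda>\<omega>. \<alpha> * diag X n (int j - 1) \<omega> + \<beta> * diag X n (int j) \<omega>)"
  proof (rule integral_cong_AE)
    show "AE \<omega> in M. real_cond_exp M (diag_sigma M X n) (indicator ?A) \<omega> =
        \<alpha> * diag X n (int j - 1) \<omega> + \<beta> * diag X n (int j) \<omega>"
      \<comment> \<open>\<open>AE_space\<close> puts \<omega> in the space, where both parents are 0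
        or 1 and the linear formula applies.\<close>
      using conditional_law [OF assms(2)] AE_space
      by eventually_elim (simp only: transition_prob_linear [OF diag_zero_one diag_zero_one assms(1)])
  qed (use borel_measurable_cond_exp2 in measurable)
  finally show ?thesis
    by simp
qed

lemma expectation_diag_sum:
  "expectation (diag_sum X n) = (\<Sum>j = 0..n. expectation (diag X n (int j)))"
  unfolding diag_sum_def [abs_def] by simp

text \<open>Summed over \<open>j\<close>, the left parents and the right parents each run once
  through row \<open>n\<close>, up to boundary zeros, so the factor is
  \<open>\<alpha> + \<beta>\<close>.\<close>

lemma expectation_diag_sum_Suc:
  assumes "\<alpha> + \<beta> = \<gamma>"
  shows "expectation (diag_sum X (Suc n)) = \<gamma> * expectation (diag_sum X n)"
proof -
  let ?e = "\<lambda>j. expectation (diag X n j)"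
  \<comment> \<open>The two boundary sites of row \<open>n\<close>; \<open>1 + int n\<close> is the
    simplifier's form of \<open>int (Suc n)\<close>.\<close>
  have [simp]: "?e (- 1) = 0" "?e (1 + int n) = 0"
    by (simp_all add: diag_def [abs_def])
  have "expectation (diag_sum X (Suc n)) = (\<Sum>j = 0..Suc n. \<alpha> * ?e (int j - 1) + \<beta> * ?e (int j))"
    by (simp only: expectation_diag_sum) (intro sum.cong refl expectation_diag_Suc assms, simp)
  also have "\<dots> = \<alpha> * (\<Sum>j = 0..Suc n. ?e (int j - 1)) + \<beta> * (\<Sum>j = 0..Suc n. ?e (int j))"
    by (simp only: sum.distrib sum_distrib_left)
  \<comment> \<open>Splitting off \<open>j = 0\<close> leaves the boundary term at -1 and shifts the
    rest back to 0..n; in the other sum the term at \<open>Suc n\<close> vanishes.\<close>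
  also have "(\<Sum>j = 0..Suc n. ?e (int j - 1)) = (\<Sum>j = 0..n. ?e (int j))"
    by (subst sum.atLeast0_atMost_Suc_shift) simp
  also have "(\<Sum>j = 0..Suc n. ?e (int j)) = (\<Sum>j = 0..n. ?e (int j))"
    by simp
  finally show ?thesis
    by (simp add: expectation_diag_sum assms [symmetric] distrib_right)
qed

lemma expectation_diag_sum_0: "expectation (diag_sum X 0) = 1"
proof -
  have "expectation (diag_sum X 0) = expectation (\<lambda>_. 1)"
    \<comment> \<open>The initial value is prescribed almost surely, hence the almost-everywhere
      congruence.\<close>
    using initial random_variables
    by (intro integral_cong_AE) (auto simp: diag_sum_def [abs_def] diag_def [abs_def])
  then show ?thesis
    by (simp add: prob_space)
qed

end

theorem mainTheorem2:
  fixes M :: "'a measure"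
    and X :: "nat \<Rightarrow> nat \<Rightarrow> 'a \<Rightarrow> real"
    and \<alpha> \<beta> \<gamma> :: real
    and n :: nat
  assumes "forest_fire M X \<alpha> \<beta> \<gamma>"
    and "\<alpha> > 0" and "\<beta> > 0" and "\<alpha> + \<beta> = 1" and "\<gamma> = 1"
  shows "prob_space.expectation M (diag_sum X n) = 1"
proof -
  interpret forest_fire M X \<alpha> \<beta> \<gamma>
    by fact
  show ?thesis
    using assms(4,5)
    by (induction n) (simp_all add: expectation_diag_sum_0 expectation_diag_sum_Suc)
qed

end
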